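(* Let $A\subseteq\mathbb{N}$ be a $C_p$-set and let $S$ be a finite subset of $\mathbb{P}$. Let $\tau=\mathbb{N}^{\mathbb{N}}$ be the set of all sequences in $\mathbb{N}$, and let $\mathcal{F}(\tau)$ denote the set of nonempty finite subsets of $\tau$. Then there exist functions $\alpha:\mathcal{F}(\tau)\to\mathbb{N}$ and $H:\mathcal{F}(\tau)\to\{\text{nonempty finite subsets of }\mathbb{N}\}$ such that (1) if $F,G\in\mathcal{F}(\tau)$ and $F\subsetneq G$, then $\max H(F)<\min H(G)$; (2) whenever $n\in\mathbb{N}$, $G_1,\dots,G_n\in\mathcal{F}(\tau)$ with $G_1\subsetneq G_2\subsetneq\cdots\subsetneq G_n$, and $f_i\in G_i$ for $i=1,\dots,n$, one has \[\sum_{i\in\beta}\alpha(G_i)+P\Big(\sum_{i\in\beta}\sum_{t\in H(G_i)}f_i(t)\Big)\in A\] for every nonempty $\beta\subseteq\{1,\dots,n\}$ and every $P\in S$.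
   Context: $\mathbb{P}$ denotes the set of polynomials with integer coefficients which vanish at $0$ and map $\mathbb{N}$ into $\mathbb{N}$. An IP-set is a family $(x_\alpha)_{\alpha}$ indexed by the nonempty finite subsets $\alpha$ of $\mathbb{N}$, obtained from a sequence $(x_n)_{n\in\mathbb{N}}$ in $\mathbb{N}$ by $x_\alpha=\sum_{t\in\alpha}x_t$. A set $A\subseteq\mathbb{N}$ is a $J_p$-set if for every finite $F\subseteq\mathbb{P}$, every $l\in\mathbb{N}$ and all IP-sets $(x^i_\alpha)_\alpha$, $i=1,\dots,l$, there exist $a\in\mathbb{N}\cup\{0\}$ and a nonempty finite $\beta\subseteq\mathbb{N}$ with $a+P(x^i_\beta)\in A$ for all $P\in F$ and $i\in\{1,\dots,l\}$. $\beta\mathbb{N}$ is the space of ultrafilters on $\mathbb{N}$ with the usual extension of addition ($A\in p+q$ iff $\{x:-x+A\in q\}\in p$, where $-x+A=\{y: x+y\in A\}$); $p$ is idempotent if $p+p=p$. $\mathcal{J}_p$ is the set of ultrafilters $p\in\beta\mathbb{N}$ all of whose members are $J_p$-sets. A set $A\subseteq\mathbb{N}$ is a $C_p$-set if $A\in p$ for some idempotent $p\in\mathcal{J}_p$. *)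

theory Defs
  imports "HOL-Library.FuncSet" "HOL-Computational_Algebra.Polynomial"
begin

text \<open>
  Natural numbers start at 1 in this development: they form the subset \<open>Npos\<close> of the type \<^typ>\<open>nat\<close>.
\<close>

abbreviation Npos :: "nat set" where
  "Npos \<equiv> {1..}"

definition finite_nonempty_subsets :: "'a set \<Rightarrow> 'a set set" where
  "finite_nonempty_subsets X = {Y. Y \<subseteq> X \<and> finite Y \<and> Y \<noteq> {}}"

text \<open>
  The extensional function space (value \<^term>\<open>undefined\<close> at 0) makes equality in
  \<open>sequences\<close> the equality of sequences indexed by \<open>Npos\<close>.
\<close>

definition sequences :: "(nat \<Rightarrow> nat) set" where
  "sequences = Npos \<rightarrow>\<^sub>E Npos"

definition pos_int_polys :: "int poly set" where
  "pos_int_polys = {P. poly P 0 = 0 \<and> (\<forall>n\<in>Npos. poly P (int n) \<in> int ` Npos)}"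

definition IP_set :: "(nat set \<Rightarrow> nat) \<Rightarrow> bool" where
  "IP_set X \<longleftrightarrow>
     (\<exists>x\<in>sequences. \<forall>\<alpha>\<in>finite_nonempty_subsets Npos. X \<alpha> = (\<Sum>t\<in>\<alpha>. x t))"

definition Jp_set :: "nat set \<Rightarrow> bool" where
  "Jp_set A \<longleftrightarrow> A \<subseteq> Npos \<and>
     (\<forall>F l X. finite F \<longrightarrow> F \<subseteq> pos_int_polys \<longrightarrow> l \<in> Npos \<longrightarrow> (\<forall>i\<in>{1..l}. IP_set (X i)) \<longrightarrow>
        (\<exists>a::nat. \<exists>\<beta>\<in>finite_nonempty_subsets Npos.
           \<forall>P\<in>F. \<forall>i\<in>{1..l}. int a + poly P (int (X i \<beta>)) \<in> int ` A))"

text \<open>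
  A point \<open>p\<close> of the space of ultrafilters on \<open>Npos\<close> is an ultrafilter on the type \<^typ>\<open>nat\<close>
  containing \<open>Npos\<close>; a set \<open>A \<subseteq> Npos\<close> is a member of \<open>p\<close> iff \<open>\<forall>\<^sub>F x in p. x \<in> A\<close>.
\<close>

definition betaN :: "nat filter set" where
  "betaN = {p. p \<noteq> bot \<and> p \<le> principal Npos \<and>
     (\<forall>P. eventually P p \<or> eventually (\<lambda>x. \<not> P x) p)}"

definition ultra_plus :: "nat filter \<Rightarrow> nat filter \<Rightarrow> nat filter" where
  "ultra_plus p q = Abs_filter (\<lambda>P. \<forall>\<^sub>F x in p. \<forall>\<^sub>F y in q. P (x + y))"

lemma eventually_ultra_plus:
  "eventually P (ultra_plus p q) \<longleftrightarrow> (\<forall>\<^sub>F x in p. \<forall>\<^sub>F y in q. P (x + y))"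
  unfolding ultra_plus_def
proof (rule eventually_Abs_filter, rule is_filter.intro)
  show "\<forall>\<^sub>F x in p. \<forall>\<^sub>F y in q. True" by simp
next
  fix P Q :: "nat \<Rightarrow> bool"
  assume "\<forall>\<^sub>F x in p. \<forall>\<^sub>F y in q. P (x + y)" "\<forall>\<^sub>F x in p. \<forall>\<^sub>F y in q. Q (x + y)"
  then show "\<forall>\<^sub>F x in p. \<forall>\<^sub>F y in q. P (x + y) \<and> Q (x + y)"
    by eventually_elim (rule eventually_conj)
next
  fix P Q :: "nat \<Rightarrow> bool"
  assume "\<forall>x. P x \<longrightarrow> Q x" "\<forall>\<^sub>F x in p. \<forall>\<^sub>F y in q. P (x + y)"
  then show "\<forall>\<^sub>F x in p. \<forall>\<^sub>F y in q. Q (x + y)"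
    by (auto elim!: eventually_mono)
qed

text \<open>The convention \<open>A \<in> p + q\<close> iff \<open>{x. -x + A \<in> q} \<in> p\<close>:\<close>

lemma mem_ultra_plus:
  "(\<forall>\<^sub>F z in ultra_plus p q. z \<in> A) \<longleftrightarrow> (\<forall>\<^sub>F x in p. x \<in> {x. \<forall>\<^sub>F y in q. y \<in> {y. x + y \<in> A}})"
  by (simp add: eventually_ultra_plus)

definition Jp_ultrafilters :: "nat filter set" where
  "Jp_ultrafilters = {p\<in>betaN. \<forall>A\<subseteq>Npos. (\<forall>\<^sub>F x in p. x \<in> A) \<longrightarrow> Jp_set A}"

definition Cp_set :: "nat set \<Rightarrow> bool" where
  "Cp_set A \<longleftrightarrow> A \<subseteq> Npos \<and>
     (\<exists>p\<in>Jp_ultrafilters. ultra_plus p p = p \<and> (\<forall>\<^sub>F x in p. x \<in> A))"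

end

theory Submission
  imports Defs "HOL-Library.Infinite_Set" "HOL-Library.Disjoint_Sets"
begin

text \<open>
  Let \<open>p\<close> be an idempotent ultrafilter of \<open>J\<^sub>p\<close>-sets containing \<open>A\<close>. As in the classical proof for
  \<open>C\<close>-sets, \<open>\<alpha>(F)\<close> and \<open>H(F)\<close> are chosen by recursion on the finite set \<open>F\<close>, keeping every partial
  value \<open>s = a + P(z)\<close> of a chain below \<open>F\<close> such that \<open>-s + A \<in> p\<close>. Idempotence makes
  \<open>{x. s + x \<in> A \<and> -(s + x) + A \<in> p}\<close> a member of \<open>p\<close>, hence so is the intersection of the finitely many sets of
  this kind, and the \<open>J\<^sub>p\<close> property of it, applied to the increments \<open>P(z + y) - P(z)\<close>,
  gives the values at \<open>F\<close>.
\<close>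

section \<open>Growth of the polynomials and divisible block sums\<close>

lemma finite_nonempty_subsets_iff:
  "Y \<in> finite_nonempty_subsets X \<longleftrightarrow> Y \<subseteq> X \<and> finite Y \<and> Y \<noteq> {}"
  by (simp add: finite_nonempty_subsets_def)

text \<open>By positivity on \<open>Npos\<close> only finitely many values up to \<open>c\<close>
  can occur, and each is taken finitely often: \<open>P\<close> is not constant, as
  \<open>P(0) = 0 < P(1)\<close>. With \<open>c = P(z)\<close> this makes the increments
  \<open>P(z + y) - P(z)\<close> eventually positive in \<open>y\<close>.\<close>

lemma pos_int_polys_finite_le:
  assumes P: "P \<in> pos_int_polys"
  shows "finite {n::nat. poly P (int n) \<le> c}"
proof -
  have P0: "poly P 0 = 0"
    using P by (simp add: pos_int_polys_def)
  have pos: "poly P (int n) > 0" if "n \<ge> 1" for n :: nat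
    using P that unfolding pos_int_polys_def by force
  have nz: "P - [:k:] \<noteq> 0" for k
  proof
    assume "P - [:k:] = 0"
    then have "poly P 0 = k" "poly P (int 1) = k"
      by simp_all
    then show False
      using P0 pos[of 1] by simp
  qed
  have "finite (int -` {x. poly (P - [:k:]) x = 0})" for k
    using poly_roots_finite[OF nz] by (rule finite_vimageI) simp
  then have fin: "finite (\<Union>k\<in>{0..c}. int -` {x. poly (P - [:k:]) x = 0})"
    by blast
  have "{n::nat. poly P (int n) \<le> c} \<subseteq> insert 0 (\<Union>k\<in>{0..c}. int -` {x. poly (P - [:k:]) x = 0})"
  proof
    fix n :: nat assume n: "n \<in> {n. poly P (int n) \<le> c}"
    show "n \<in> insert 0 (\<Union>k\<in>{0..c}. int -` {x. poly (P - [:k:]) x = 0})"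
      using n pos[of n] by (cases "n = 0") (auto simp: less_imp_le)
  qed
  then show ?thesis
    using fin finite_subset by blast
qed

text \<open>Pigeonhole: infinitely many indices \<open>t > m\<close> share all residues
  \<open>f t mod N\<close>, \<open>f \<in> L\<close>, and over any \<open>N\<close> of these indices
  each \<open>f\<close> sums to a multiple of \<open>N\<close>.\<close>

lemma blocks_with_divisible_sums:
  fixes L :: "(nat \<Rightarrow> nat) set"
  assumes "finite L" and N: "N > 0"
  shows "\<exists>B :: nat \<Rightarrow> nat set. disjoint_family B \<and>
    (\<forall>k. finite (B k) \<and> B k \<noteq> {} \<and> B k \<subseteq> {m<..} \<and> (\<forall>f\<in>L. N dvd sum f (B k)))"
proof -
  \<comment> \<open>The residues at \<open>t\<close> of all \<open>f \<in> L\<close> together;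
    restricting to \<open>L\<close> puts \<open>r t\<close> in a finite function space.\<close>
  define r where "r = (\<lambda>t. restrict (\<lambda>f. f t mod N) L)"
  have "r ` {m<..} \<subseteq> L \<rightarrow>\<^sub>E {..<N}"
    using N by (auto simp: r_def)
  then have "finite (r ` {m<..})"
    by (rule finite_subset) (intro finite_PiE assms finite_lessThan)
  then obtain t0 where t0: "infinite {t \<in> {m<..}. r t = r t0}"
    using pigeonhole_infinite[of "{m<..}" r] infinite_Ioi by blast
  define e where "e = enumerate {t \<in> {m<..}. r t = r t0}"
  have e: "e j > m" "r (e j) = r t0" for j
    using enumerate_in_set[OF t0, of j] by (auto simp: e_def)
  have inj: "inj e"
    unfolding e_def using t0 by (rule inj_enumerate)
  \<comment> \<open>Successive runs of \<open>N\<close> terms of the enumeration give infinitely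
    many disjoint blocks.\<close>
  define B where "B = (\<lambda>k. e ` {k * N..<k * N + N})"
  show ?thesis
  proof (intro exI conjI allI ballI)
    show "finite (B k)" "B k \<noteq> {}" "B k \<subseteq> {m<..}" for k
      using N e by (auto simp: B_def)
    show "disjoint_family B"
    proof (unfold disjoint_family_on_def, intro ballI impI)
      fix k l :: nat assume "k \<noteq> l"
      have "j div N = k" if "j \<in> {k * N..<k * N + N}" for j k
        using that by (intro div_nat_eqI) (auto simp: mult.commute)
      then have "{k * N..<k * N + N} \<inter> {l * N..<l * N + N} = {}"
        using \<open>k \<noteq> l\<close> by blast
      then show "B k \<inter> B l = {}"
        unfolding B_def by (simp add: image_Int[OF inj, symmetric])
    qed
    show "N dvd sum f (B k)" if f: "f \<in> L" for f k
    proof -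
    have "f (e j) mod N = f t0 mod N" for j
      using fun_cong[OF e(2)[of j], of f] f by (simp add: r_def)
    moreover have "sum f (B k) = (\<Sum>j\<in>{k * N..<k * N + N}. f (e j))"
      unfolding B_def using inj by (subst sum.reindex) (auto intro: inj_on_subset)
    ultimately have "sum f (B k) mod N = (\<Sum>j\<in>{k * N..<k * N + N}. f t0 mod N) mod N"
      by (simp add: mod_sum_eq[symmetric, of "\<lambda>j. f (e j)"] del: sum_constant)
    then show ?thesis
      by (simp add: mod_eq_0_iff_dvd)
    qed
  qed
qed

section \<open>The \<open>J\<^sub>p\<close> property for eventually positive polynomials\<close>

text \<open>
  Polynomials that are merely eventually positive on \<^term>\<open>Npos\<close> are admitted here: passing to an
  IP-subset with all sums divisible by a large \<open>N\<close> replaces \<open>Q(y)\<close> by \<open>Q(N x)\<close>.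
\<close>

lemma Jp_set_eventually_positive:
  assumes A: "Jp_set A"
    and Qs: "finite Qs" "\<And>Q. Q \<in> Qs \<Longrightarrow> poly Q 0 = 0" "\<And>Q. Q \<in> Qs \<Longrightarrow> finite {n::nat. poly Q (int n) \<le> 0}"
    and L: "L \<in> finite_nonempty_subsets sequences"
  shows "\<exists>(a::nat) H. finite H \<and> H \<noteq> {} \<and> H \<subseteq> {m<..} \<and>
    (\<forall>Q\<in>Qs. \<forall>f\<in>L. int a + poly Q (int (sum f H)) \<in> int ` A)"
proof -
  have finL: "finite L" and Lne: "L \<noteq> {}" and Lseq: "L \<subseteq> sequences"
    using L by (auto simp: finite_nonempty_subsets_iff)
  have "finite (\<Union>Q\<in>Qs. {n::nat. poly Q (int n) \<le> 0})"
    using Qs by blast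
  then obtain N where N: "n < N" if "n \<in> (\<Union>Q\<in>Qs. {n::nat. poly Q (int n) \<le> 0})" for n
    using finite_nat_set_iff_bounded by meson
  \<comment> \<open>Every positive multiple of \<open>M\<close> lies beyond all points where some
    \<open>Q\<close> is nonpositive.\<close>
  define M where "M = Suc N"
  have "M > 0" by (simp add: M_def)
  obtain B :: "nat \<Rightarrow> nat set" where disj: "disjoint_family B" and
    B: "\<forall>k. finite (B k) \<and> B k \<noteq> {} \<and> B k \<subseteq> {m<..} \<and> (\<forall>f\<in>L. M dvd sum f (B k))"
    using blocks_with_divisible_sums[OF finL \<open>M > 0\<close>, of m] by blast
  then have B: "finite (B k)" "B k \<noteq> {}" "B k \<subseteq> {m<..}" "f \<in> L \<Longrightarrow> M dvd sum f (B k)" for k f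
    by simp_all
  \<comment> \<open>Over a union of blocks indexed in \<open>Npos\<close>, the sum of
    \<open>f\<close> is \<open>M\<close> times the corresponding IP-sum of
    \<open>x f\<close>.\<close>
  define x where "x = (\<lambda>f. restrict (\<lambda>k. sum f (B k) div M) Npos)"
  have xseq: "x f \<in> sequences" if "f \<in> L" for f
  proof -
    have "sum f (B k) div M \<ge> 1" for k
    proof -
      have "f t \<ge> 1" if "t \<in> B k" for t
        using B(3)[of k] that Lseq \<open>f \<in> L\<close> unfolding sequences_def
        by (force simp: PiE_iff)
      then have "sum f (B k) > 0"
        using B(1,2) by (intro sum_pos) (auto simp: Suc_le_eq)
      then show ?thesis
        using B(4)[OF that, of k] \<open>M > 0\<close>
        by (auto simp: dvd_def)
    qed
    then show ?thesis
      by (auto simp: x_def sequences_def)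
  qed
  \<comment> \<open>On \<open>Npos\<close> the polynomial \<open>Q(M * y)\<close> only takes values
    of \<open>Q\<close> beyond its exceptional points, so it is positive there.\<close>
  define R where "R = (\<lambda>Q. pcompose Q [:0, int M:]) ` Qs"
  have R: "R \<subseteq> pos_int_polys"
  proof (clarsimp simp: R_def pos_int_polys_def poly_pcompose Qs(2))
    fix Q and n :: nat assume Q: "Q \<in> Qs" and n: "Suc 0 \<le> n"
    have "M * 1 \<le> M * n"
      using n by (intro mult_le_mono) auto
    then have "\<not> n * M < N"
      by (simp add: M_def mult.commute)
    then have "\<not> poly Q (int (n * M)) \<le> 0"
      using N[of "n * M"] Q by blast
    then show "poly Q (int n * int M) \<in> int ` {Suc 0..}"
      by (intro image_eqI[of _ _ "nat (poly Q (int n * int M))"]) auto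
  qed
  obtain h where h: "bij_betw h {1..card L} L"
    using ex_bij_betw_nat_finite_1[OF finL] by blast
  have "card L \<in> Npos"
    using finL Lne by (simp add: Suc_le_eq card_gt_0_iff)
  moreover have "\<forall>i\<in>{1..card L}. IP_set (\<lambda>\<beta>. \<Sum>t\<in>\<beta>. x (h i) t)"
    using xseq h unfolding IP_set_def by (auto dest: bij_betwE)
  moreover have "finite R"
    using Qs by (simp add: R_def)
  ultimately obtain a \<beta> where \<beta>: "\<beta> \<in> finite_nonempty_subsets Npos"
    and a: "\<And>P i. P \<in> R \<Longrightarrow> i \<in> {1..card L} \<Longrightarrow> int a + poly P (int (\<Sum>t\<in>\<beta>. x (h i) t)) \<in> int ` A"
    using A[unfolded Jp_set_def, THEN conjunct2, rule_format, of R "card L" "\<lambda>i \<beta>. \<Sum>t\<in>\<beta>. x (h i) t"] R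
    by blast
  have fin\<beta>: "finite \<beta>" and \<beta>ne: "\<beta> \<noteq> {}" and \<beta>pos: "\<beta> \<subseteq> Npos"
    using \<beta> by (auto simp: finite_nonempty_subsets_iff)
  show ?thesis
  proof (intro exI conjI ballI)
    \<comment> \<open>The witness is the union of the blocks selected by
      \<open>\<beta>\<close>.\<close>
    show "finite (\<Union>(B ` \<beta>))" "\<Union>(B ` \<beta>) \<noteq> {}" "\<Union>(B ` \<beta>) \<subseteq> {m<..}"
      using fin\<beta> \<beta>ne B by auto
    show "int a + poly Q (int (sum f (\<Union>(B ` \<beta>)))) \<in> int ` A"
      if Q: "Q \<in> Qs" and f: "f \<in> L" for Q f
    proof -
      obtain i where i: "i \<in> {1..card L}" "h i = f"
        using h f by (metis bij_betw_def imageE)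
      have "sum f (\<Union>(B ` \<beta>)) = (\<Sum>k\<in>\<beta>. sum f (B k))"
        using fin\<beta> B(1) disj by (intro sum.UNION_disjoint) (auto simp: disjoint_family_on_def)
      also have "\<dots> = (\<Sum>k\<in>\<beta>. M * x f k)"
        using B(4)[OF f] \<beta>pos by (intro sum.cong) (auto simp: x_def)
      also have "\<dots> = M * (\<Sum>k\<in>\<beta>. x f k)"
        by (simp add: sum_distrib_left)
      finally have "int (sum f (\<Union>(B ` \<beta>))) = int (\<Sum>k\<in>\<beta>. x f k) * int M"
        by simp
      moreover have "int a + poly (pcompose Q [:0, int M:]) (int (\<Sum>k\<in>\<beta>. x f k)) \<in> int ` A"
        using a[of "pcompose Q [:0, int M:]" i] Q i by (auto simp: R_def)
      ultimately show ?thesis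
        by (simp add: poly_pcompose)
    qed
  qed
qed

section \<open>Idempotence and the extension of a chain by one set\<close>

definition translate_in :: "nat filter \<Rightarrow> nat set \<Rightarrow> nat \<Rightarrow> bool" where
  "translate_in p A s \<longleftrightarrow> (\<forall>\<^sub>F x in p. s + x \<in> A)"

text \<open>Reading \<open>p\<close> as \<open>p + p\<close> in \<open>-s + A \<in> p\<close> gives
  \<open>-(s + x) + A \<in> p\<close> for \<open>p\<close>-almost all \<open>x\<close>; intersecting
  with \<open>-s + A\<close> itself yields both properties at once.\<close>

lemma translate_in_idempotent:
  assumes "ultra_plus p p = p" and "translate_in p A s"
  shows "\<forall>\<^sub>F x in p. s + x \<in> A \<and> translate_in p A (s + x)"
proof -
  have "\<forall>\<^sub>F x in ultra_plus p p. s + x \<in> A"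
    using assms by (simp add: translate_in_def)
  then have "\<forall>\<^sub>F x in p. translate_in p A (s + x)"
    by (simp add: eventually_ultra_plus translate_in_def add.assoc)
  with assms(2) show ?thesis
    unfolding translate_in_def by (rule eventually_conj)
qed

text \<open>
  With \<open>s = a + P(z)\<close> one has \<open>(a + \<alpha>) + P(z + y) = s + (\<alpha> + Q(y))\<close> for \<open>Q(y) = P(z + y) - P(z)\<close>,
  and \<open>Q\<close> is eventually positive even though it need not be positive.
  Translating by a generic \<open>c \<ge> 1\<close> first makes \<open>\<alpha>\<close> positive, which \<^const>\<open>Jp_set\<close> does not provide.
\<close>

lemma extension_step:
  assumes p: "p \<in> Jp_ultrafilters" "ultra_plus p p = p"
    and S: "finite S" "S \<subseteq> pos_int_polys"
    and F: "F \<in> finite_nonempty_subsets sequences"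
    and M: "finite M" "\<And>a z P. (a, z) \<in> M \<Longrightarrow> P \<in> S \<Longrightarrow> translate_in p A (nat (int a + poly P (int z)))"
  obtains \<alpha> H where "\<alpha> \<in> Npos" "finite H" "H \<noteq> {}" "H \<subseteq> {m<..}"
    "\<And>a z f P. (a, z) \<in> M \<Longrightarrow> f \<in> F \<Longrightarrow> P \<in> S \<Longrightarrow>
       int (a + \<alpha>) + poly P (int (z + sum f H)) \<in> int ` A \<and>
       translate_in p A (nat (int (a + \<alpha>) + poly P (int (z + sum f H))))"
proof -
  have pbeta: "p \<noteq> bot" "p \<le> principal Npos"
    and pJ: "\<And>A. A \<subseteq> Npos \<Longrightarrow> \<forall>\<^sub>F x in p. x \<in> A \<Longrightarrow> Jp_set A"
    using p(1) by (auto simp: Jp_ultrafilters_def betaN_def)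
  have Nev: "\<forall>\<^sub>F x in p. x \<in> Npos"
    using pbeta(2) by (simp add: le_principal)
  \<comment> \<open>Ensures that \<open>nat\<close> does not truncate partial values;
    \<open>z = 0\<close> is separate because \<open>pos_int_polys\<close> gives positivity only on
    \<open>Npos\<close>.\<close>
  have Pnonneg: "poly P (int z) \<ge> 0" if "P \<in> S" for P z
  proof (cases "z = 0")
    case False
    then have "poly P (int z) \<in> int ` Npos"
      using that S(2) by (auto simp: pos_int_polys_def subset_iff)
    then show ?thesis
      by auto
  qed (use that S(2) in \<open>auto simp: pos_int_polys_def\<close>)
  define s where "s = (\<lambda>((a, z), P). nat (int a + poly P (int z)))"
  define U where "U = {x. \<forall>w\<in>M \<times> S. s w + x \<in> A \<and> translate_in p A (s w + x)}"
  have "\<forall>\<^sub>F x in p. \<forall>w\<in>M \<times> S. s w + x \<in> A \<and> translate_in p A (s w + x)"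
    using M S by (intro eventually_ball_finite ballI translate_in_idempotent p) (auto simp: s_def)
  then have U: "\<forall>\<^sub>F x in p. x \<in> U"
    by (simp add: U_def)
  \<comment> \<open>Idempotence a second time, now for \<open>U\<close>: since \<open>p\<close> is
    proper and contains \<open>Npos\<close>, some \<open>c \<ge> 1\<close> satisfies
    \<open>-c + U \<in> p\<close>.\<close>
  then have "\<forall>\<^sub>F x in ultra_plus p p. x \<in> U"
    by (simp add: p(2))
  then have "\<forall>\<^sub>F c in p. \<forall>\<^sub>F x in p. c + x \<in> U"
    by (simp add: eventually_ultra_plus)
  then have "\<exists>c. c \<in> Npos \<and> (\<forall>\<^sub>F x in p. c + x \<in> U)"
    using eventually_happens'[OF pbeta(1) eventually_conj[OF Nev]] by blast
  then obtain c where c: "c \<in> Npos" "\<forall>\<^sub>F x in p. c + x \<in> U"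
    by blast
  define V where "V = {x \<in> Npos. c + x \<in> U}"
  have "Jp_set V"
    using eventually_conj[OF Nev c(2)] by (intro pJ) (auto simp: V_def)
  define q where "q = (\<lambda>((a::nat, z), P). pcompose P [:int z, 1:] - [:poly P (int z):])"
  have q: "poly (q ((a, z), P)) (int y) = poly P (int (z + y)) - poly P (int z)" for a z P y
    by (simp add: q_def poly_pcompose)
  have qfin: "finite {n::nat. poly (q w) (int n) \<le> 0}" if w_in: "w \<in> M \<times> S" for w
  proof -
    obtain a z P where w: "w = ((a, z), P)" "P \<in> S"
      using w_in by (intro that[of "fst (fst w)" "snd (fst w)" "snd w"]) auto
    \<comment> \<open>Shifting by \<open>z\<close> turns \<open>Q(y) \<le> 0\<close> into
      \<open>P(z + y) \<le> P(z)\<close>.\<close>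
    have "finite ((+) z -` {n::nat. poly P (int n) \<le> poly P (int z)})"
      using w(2) S(2) by (intro finite_vimageI pos_int_polys_finite_le) auto
    then show ?thesis
      by (simp add: w(1) q vimage_def)
  qed
  have q0: "poly (q w) 0 = 0" for w
    by (auto simp: q_def poly_pcompose split: prod.splits)
  have Qs: "finite (q ` (M \<times> S))" "\<And>Q. Q \<in> q ` (M \<times> S) \<Longrightarrow> poly Q 0 = 0"
    "\<And>Q. Q \<in> q ` (M \<times> S) \<Longrightarrow> finite {n::nat. poly Q (int n) \<le> 0}"
    using M(1) S(1) q0 qfin by blast+
  have "\<exists>(a::nat) H. finite H \<and> H \<noteq> {} \<and> H \<subseteq> {m<..} \<and>
      (\<forall>Q\<in>q ` (M \<times> S). \<forall>f\<in>F. int a + poly Q (int (sum f H)) \<in> int ` V)"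
    by (rule Jp_set_eventually_positive[OF \<open>Jp_set V\<close> Qs F])
  then obtain a0 :: nat and H where H: "finite H" "H \<noteq> {}" "H \<subseteq> {m<..}"
    and a0: "\<forall>Q\<in>q ` (M \<times> S). \<forall>f\<in>F. int a0 + poly Q (int (sum f H)) \<in> int ` V"
    by (elim exE conjE)
  show thesis
  proof (rule that)
    show "c + a0 \<in> Npos"
      using c(1) by simp
    show "finite H" "H \<noteq> {}" "H \<subseteq> {m<..}"
      by (fact H)+
    fix a z f P assume az: "(a, z) \<in> M" and f: "f \<in> F" and P: "P \<in> S"
    have "int a0 + poly (q ((a, z), P)) (int (sum f H)) \<in> int ` V"
      using a0 az P f by blast
    then obtain v where v: "v \<in> V" "int v = int a0 + poly P (int (z + sum f H)) - poly P (int z)"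
      by (auto simp only: q add_diff_eq)
    \<comment> \<open>The \<open>P(z)\<close> contained in \<open>s\<close> cancels the
      \<open>- P(z)\<close> of the increment.\<close>
    have eq: "int (a + (c + a0)) + poly P (int (z + sum f H)) = int (s ((a, z), P) + (c + v))"
      using v(2) Pnonneg[OF P, of z] by (simp add: s_def)
    have "c + v \<in> U"
      using v(1) by (simp add: V_def)
    then have "s ((a, z), P) + (c + v) \<in> A \<and> translate_in p A (s ((a, z), P) + (c + v))"
      using az P unfolding U_def by blast
    then show "int (a + (c + a0)) + poly P (int (z + sum f H)) \<in> int ` A \<and>
        translate_in p A (nat (int (a + (c + a0)) + poly P (int (z + sum f H))))"
      unfolding eq nat_int by blast
  qed
qed

section \<open>Recursion on finite sets of sequences\<close>

text \<open>
  The pairs \<open>(\<Sum> \<alpha>(G\<^sub>i), \<Sum> \<Sum> f\<^sub>i(t))\<close> over chains whose largest member is \<open>F\<close> form the set \<open>T F\<close>;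
  \<open>(0, 0)\<close> accounts for the empty chain below \<open>F\<close>.
\<close>

lemma recursive_construction:
  assumes p: "p \<in> Jp_ultrafilters" "ultra_plus p p = p" "\<forall>\<^sub>F x in p. x \<in> A"
    and S: "finite S" "S \<subseteq> pos_int_polys"
  obtains \<alpha> :: "(nat \<Rightarrow> nat) set \<Rightarrow> nat" and H and T :: "(nat \<Rightarrow> nat) set \<Rightarrow> (nat \<times> nat) set" where
    "\<alpha> \<in> finite_nonempty_subsets sequences \<rightarrow> Npos"
    "H \<in> finite_nonempty_subsets sequences \<rightarrow> finite_nonempty_subsets Npos"
    "\<And>F G. F \<in> finite_nonempty_subsets sequences \<Longrightarrow> G \<in> finite_nonempty_subsets sequences \<Longrightarrow>
       F \<subset> G \<Longrightarrow> Max (H F) < Min (H G)"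
    "\<And>F a z P. F \<in> finite_nonempty_subsets sequences \<Longrightarrow> (a, z) \<in> T F \<Longrightarrow> P \<in> S \<Longrightarrow>
       int a + poly P (int z) \<in> int ` A"
    "\<And>F a z f. F \<in> finite_nonempty_subsets sequences \<Longrightarrow>
       (a, z) = (0, 0) \<or> (\<exists>G\<in>finite_nonempty_subsets sequences. G \<subset> F \<and> (a, z) \<in> T G) \<Longrightarrow> f \<in> F \<Longrightarrow>
       (a + \<alpha> F, z + sum f (H F)) \<in> T F"
proof -
  let ?\<F> = "finite_nonempty_subsets sequences"
  define below where "below = (\<lambda>F. {G \<in> ?\<F>. G \<subset> F})"
  define prev :: "((nat \<Rightarrow> nat) set \<Rightarrow> nat \<times> nat set \<times> (nat \<times> nat) set) \<Rightarrow> (nat \<Rightarrow> nat) set \<Rightarrow> (nat \<times> nat) set"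
    where "prev = (\<lambda>d F. insert (0, 0) (\<Union>G\<in>below F. snd (snd (d G))))"
  \<comment> \<open>Finiteness of \<open>T\<close> and the \<open>translate_in\<close> clause are
    the invariants that let \<open>extension_step\<close> be applied at larger sets. The condition
    is vacuous outside \<open>?\<F>\<close>, so the recursion can range over all sets.\<close>
  define good where "good = (\<lambda>d F (\<alpha>, H, T). F \<in> ?\<F> \<longrightarrow>
      \<alpha> \<in> Npos \<and> H \<in> finite_nonempty_subsets Npos \<and>
      (\<forall>G\<in>below F. Max (fst (snd (d G))) < Min H) \<and>
      T = (\<lambda>((a, z), f). (a + \<alpha>, z + sum f H)) ` (prev d F \<times> F) \<and> finite T \<and>
      (\<forall>(a, z)\<in>T. \<forall>P\<in>S. int a + poly P (int z) \<in> int ` A \<and>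
         translate_in p A (nat (int a + poly P (int z)))))"
  \<comment> \<open>Choice along \<open>finite_psubset\<close> requires that \<open>good d F\<close>
    depend only on the values of \<open>d\<close> at sets below \<open>F\<close>.\<close>
  have "\<exists>d. \<forall>F. good d F (d F)"
  proof (rule dependent_wf_choice[OF wf_finite_psubset])
    fix d d' :: "(nat \<Rightarrow> nat) set \<Rightarrow> nat \<times> nat set \<times> (nat \<times> nat) set" and F r
    assume eq: "\<And>G. (G, F) \<in> finite_psubset \<Longrightarrow> d G = d' G"
    show "good d F r = good d' F r"
    proof (cases "F \<in> ?\<F>")
      case True
      then have "d G = d' G" if "G \<in> below F" for G
        using that by (intro eq) (auto simp: below_def finite_psubset_def finite_nonempty_subsets_iff)
      then show ?thesis
        by (simp add: good_def prev_def cong: ball_cong)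
    qed (auto simp: good_def)
  next
    fix F and d :: "(nat \<Rightarrow> nat) set \<Rightarrow> nat \<times> nat set \<times> (nat \<times> nat) set"
    assume IH: "\<And>G. (G, F) \<in> finite_psubset \<Longrightarrow> good d G (d G)"
    show "\<exists>r. good d F r"
    proof (cases "F \<in> ?\<F>")
      case F: True
      then have finF: "finite F"
        by (simp add: finite_nonempty_subsets_iff)
      \<comment> \<open>A finite \<open>F\<close> has finitely many subsets, so only finitely many
        pairs must be extended simultaneously.\<close>
      have finb: "finite (below F)"
        using finF by (auto simp: below_def intro: finite_subset[of _ "Pow F"])
      have IH': "good d G (d G)" "G \<in> ?\<F>" if "G \<in> below F" for G
        using that finF by (auto simp: below_def finite_psubset_def intro!: IH)
      have goodT: "finite (snd (snd (d G)))"
        "\<And>a z P. (a, z) \<in> snd (snd (d G)) \<Longrightarrow> P \<in> S \<Longrightarrow> translate_in p A (nat (int a + poly P (int z)))"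
        if "G \<in> below F" for G
        using IH'[OF that] by (cases "d G"; force simp: good_def)+
      have fin: "finite (prev d F)"
        using finb goodT(1) by (simp add: prev_def)
      have "translate_in p A (nat (int a + poly P (int z)))" if "(a, z) \<in> prev d F" "P \<in> S" for a z P
      proof (cases "(a, z) = (0, 0)")
        \<comment> \<open>Since \<open>P(0) = 0\<close>, the invariant for the empty chain is just
          \<open>A \<in> p\<close>.\<close>
        case True
        then show ?thesis
          using p(3) S(2) that(2) by (auto simp: translate_in_def pos_int_polys_def)
      qed (use that goodT(2) in \<open>auto simp: prev_def\<close>)
      \<comment> \<open>The bound lies at or above the maximum of every \<open>H\<close> chosen
        below \<open>F\<close>; the inserted \<open>0\<close> covers an empty \<open>below F\<close>
        and forces the new \<open>H\<close> into \<open>Npos\<close>.\<close>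
      from extension_step[OF p(1,2) S F fin this, of "Max (insert 0 ((\<lambda>G. Max (fst (snd (d G)))) ` below F))"]
      obtain \<alpha> H where \<alpha>: "\<alpha> \<in> Npos" and H: "finite H" "H \<noteq> {}"
        "H \<subseteq> {Max (insert 0 ((\<lambda>G. Max (fst (snd (d G)))) ` below F))<..}"
        and step: "\<And>a z f P. (a, z) \<in> prev d F \<Longrightarrow> f \<in> F \<Longrightarrow> P \<in> S \<Longrightarrow>
          int (a + \<alpha>) + poly P (int (z + sum f H)) \<in> int ` A \<and>
          translate_in p A (nat (int (a + \<alpha>) + poly P (int (z + sum f H))))"
        by metis
      have H': "k < t" if "t \<in> H" "k \<in> insert 0 ((\<lambda>G. Max (fst (snd (d G)))) ` below F)" for t k
        using H(3) that finb by auto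
      define T where "T = (\<lambda>((a, z), f). (a + \<alpha>, z + sum f H)) ` (prev d F \<times> F)"
      have "H \<subseteq> Npos"
        using H'[of _ 0] by (auto simp: Suc_le_eq)
      moreover have "\<forall>G\<in>below F. Max (fst (snd (d G))) < Min H"
        using H' H(1,2) by auto
      moreover have "finite T"
        using fin finF by (simp add: T_def)
      moreover have "\<forall>(a, z)\<in>T. \<forall>P\<in>S. int a + poly P (int z) \<in> int ` A \<and>
         translate_in p A (nat (int a + poly P (int z)))"
        using step unfolding T_def by auto
      ultimately have "good d F (\<alpha>, H, T)"
        using \<alpha> H(1,2) unfolding good_def T_def finite_nonempty_subsets_iff by auto
      then show ?thesis ..
    qed (auto simp: good_def)
  qed
  then obtain d where d: "\<And>F. good d F (d F)"
    by blast
  define \<alpha> where "\<alpha> = (\<lambda>F. fst (d F))"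
  define H where "H = (\<lambda>F. fst (snd (d F)))"
  define T where "T = (\<lambda>F. snd (snd (d F)))"
  have d': "d F = (\<alpha> F, H F, T F)" for F
    by (simp add: \<alpha>_def H_def T_def)
  have props: "\<alpha> F \<in> Npos" "H F \<in> finite_nonempty_subsets Npos" "\<And>G. G \<in> below F \<Longrightarrow> Max (H G) < Min (H F)"
    "T F = (\<lambda>((a, z), f). (a + \<alpha> F, z + sum f (H F))) ` (prev d F \<times> F)"
    "\<And>a z P. (a, z) \<in> T F \<Longrightarrow> P \<in> S \<Longrightarrow> int a + poly P (int z) \<in> int ` A" if "F \<in> ?\<F>" for F
  proof -
    have *: "\<alpha> F \<in> Npos \<and> H F \<in> finite_nonempty_subsets Npos \<and>
      (\<forall>G\<in>below F. Max (H G) < Min (H F)) \<and>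
      T F = (\<lambda>((a, z), f). (a + \<alpha> F, z + sum f (H F))) ` (prev d F \<times> F) \<and> finite (T F) \<and>
      (\<forall>(a, z)\<in>T F. \<forall>P\<in>S. int a + poly P (int z) \<in> int ` A \<and>
         translate_in p A (nat (int a + poly P (int z))))"
      using mp[OF d[of F, unfolded good_def d' prod.case fst_conv snd_conv, folded d'] that] .
    note ** = * *[THEN conjunct2] *[THEN conjunct2, THEN conjunct2] *[THEN conjunct2, THEN conjunct2, THEN conjunct2]
    show "\<alpha> F \<in> Npos" "H F \<in> finite_nonempty_subsets Npos"
      "T F = (\<lambda>((a, z), f). (a + \<alpha> F, z + sum f (H F))) ` (prev d F \<times> F)"
      by (fact **(1,2,4)[THEN conjunct1])+
    show "\<And>G. G \<in> below F \<Longrightarrow> Max (H G) < Min (H F)"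
      using **(3)[THEN conjunct1] by (rule bspec)
    show "int a + poly P (int z) \<in> int ` A" if "(a, z) \<in> T F" "P \<in> S" for a z P
      using bspec[OF **(4)[THEN conjunct2, THEN conjunct2] that(1), unfolded prod.case] that(2) by blast
  qed
  show thesis
  proof (rule that)
    show "\<alpha> \<in> ?\<F> \<rightarrow> Npos" "H \<in> ?\<F> \<rightarrow> finite_nonempty_subsets Npos"
      using props(1,2) by blast+
    show "Max (H F) < Min (H G)" if "F \<in> ?\<F>" "G \<in> ?\<F>" "F \<subset> G" for F G
      using that by (intro props(3)) (auto simp: below_def)
    show "int a + poly P (int z) \<in> int ` A" if "F \<in> ?\<F>" "(a, z) \<in> T F" "P \<in> S" for F a z P
      using props(5) that by blast
    show "(a + \<alpha> F, z + sum f (H F)) \<in> T F"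
      if "F \<in> ?\<F>" "(a, z) = (0, 0) \<or> (\<exists>G\<in>?\<F>. G \<subset> F \<and> (a, z) \<in> T G)" "f \<in> F" for F a z f
    proof -
      have "(a, z) \<in> prev d F"
        using that(2) by (auto simp: prev_def below_def T_def)
      then show ?thesis
        unfolding props(4)[OF that(1)] using that(3) by force
    qed
  qed
qed

section \<open>Sums along chains\<close>

theorem theorem2p10:
  fixes A :: "nat set" and S :: "int poly set"
  assumes "Cp_set A" and "finite S" and "S \<subseteq> pos_int_polys"
  shows "\<exists>\<alpha> \<in> finite_nonempty_subsets sequences \<rightarrow> Npos.
         \<exists>H \<in> finite_nonempty_subsets sequences \<rightarrow> finite_nonempty_subsets Npos.
           (\<forall>F\<in>finite_nonempty_subsets sequences. \<forall>G\<in>finite_nonempty_subsets sequences.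
              F \<subset> G \<longrightarrow> Max (H F) < Min (H G)) \<and>
           (\<forall>n\<in>Npos. \<forall>(G :: nat \<Rightarrow> (nat \<Rightarrow> nat) set) (f :: nat \<Rightarrow> nat \<Rightarrow> nat).
              (\<forall>i\<in>{1..n}. G i \<in> finite_nonempty_subsets sequences) \<longrightarrow>
              (\<forall>i\<in>{1..<n}. G i \<subset> G (Suc i)) \<longrightarrow>
              (\<forall>i\<in>{1..n}. f i \<in> G i) \<longrightarrow>
              (\<forall>\<beta>\<in>finite_nonempty_subsets {1..n}. \<forall>P\<in>S.
                 int (\<Sum>i\<in>\<beta>. \<alpha> (G i)) + poly P (int (\<Sum>i\<in>\<beta>. \<Sum>t\<in>H (G i). f i t)) \<in> int ` A))"
proof -
  let ?\<F> = "finite_nonempty_subsets sequences"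
  obtain p where p: "p \<in> Jp_ultrafilters" "ultra_plus p p = p" "\<forall>\<^sub>F x in p. x \<in> A"
    using assms(1) by (auto simp: Cp_set_def)
  obtain \<alpha> :: "(nat \<Rightarrow> nat) set \<Rightarrow> nat" and H and T :: "(nat \<Rightarrow> nat) set \<Rightarrow> (nat \<times> nat) set"
    where \<alpha>: "\<alpha> \<in> ?\<F> \<rightarrow> Npos" and H: "H \<in> ?\<F> \<rightarrow> finite_nonempty_subsets Npos"
    and less: "\<And>F G. F \<in> ?\<F> \<Longrightarrow> G \<in> ?\<F> \<Longrightarrow> F \<subset> G \<Longrightarrow> Max (H F) < Min (H G)"
    and T: "\<And>F a z P. F \<in> ?\<F> \<Longrightarrow> (a, z) \<in> T F \<Longrightarrow> P \<in> S \<Longrightarrow> int a + poly P (int z) \<in> int ` A"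
    and step: "\<And>F a z f. F \<in> ?\<F> \<Longrightarrow>
       (a, z) = (0, 0) \<or> (\<exists>G\<in>?\<F>. G \<subset> F \<and> (a, z) \<in> T G) \<Longrightarrow> f \<in> F \<Longrightarrow>
       (a + \<alpha> F, z + sum f (H F)) \<in> T F"
    by (rule recursive_construction[OF p assms(2,3)]) blast
  have chain_sum: "int (\<Sum>i\<in>\<beta>. \<alpha> (G i)) + poly P (int (\<Sum>i\<in>\<beta>. \<Sum>t\<in>H (G i). f i t)) \<in> int ` A"
    if G: "\<forall>i\<in>{1..n}. G i \<in> ?\<F>" "\<forall>i\<in>{1..<n}. G i \<subset> G (Suc i)" and f: "\<forall>i\<in>{1..n}. f i \<in> G i"
      and \<beta>: "\<beta> \<in> finite_nonempty_subsets {1..n}" and P: "P \<in> S"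
    for n :: nat and G :: "nat \<Rightarrow> (nat \<Rightarrow> nat) set" and f :: "nat \<Rightarrow> nat \<Rightarrow> nat" and \<beta> P
  proof -
    have mono: "G i \<subset> G j" if "i < j" "1 \<le> i" "j \<le> n" for i j
      using that
    proof (induction j)
      case (Suc j)
      then have "G j \<subset> G (Suc j)"
        using G(2) by auto
      with Suc show ?case
        by (cases "i = j") (auto dest: psubset_trans)
    qed simp
    \<comment> \<open>Indices are added in increasing order: by \<open>mono\<close>,
      \<open>G\<close> at the old maximum is a proper subset of \<open>G b\<close>, so
      \<open>step\<close> appends \<open>G b\<close> to the pair already reached, or to
      \<open>(0, 0)\<close> at the start.\<close>
    have "finite \<gamma> \<Longrightarrow> \<gamma> \<subseteq> {1..n} \<Longrightarrow> \<gamma> \<noteq> {} \<Longrightarrow>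
        (\<Sum>i\<in>\<gamma>. \<alpha> (G i), \<Sum>i\<in>\<gamma>. \<Sum>t\<in>H (G i). f i t) \<in> T (G (Max \<gamma>))" for \<gamma>
    proof (induction \<gamma> rule: finite_linorder_max_induct)
      case (insert b \<gamma>)
      have b: "b \<in> {1..n}" and "b \<notin> \<gamma>"
        using insert by auto
      have "Max (insert b \<gamma>) = b"
        using insert by (intro Max_eqI) (auto simp: less_imp_le)
      moreover have "(\<Sum>i\<in>\<gamma>. \<alpha> (G i), \<Sum>i\<in>\<gamma>. \<Sum>t\<in>H (G i). f i t) = (0, 0) \<or>
        (\<exists>F\<in>?\<F>. F \<subset> G b \<and> (\<Sum>i\<in>\<gamma>. \<alpha> (G i), \<Sum>i\<in>\<gamma>. \<Sum>t\<in>H (G i). f i t) \<in> T F)"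
      proof (cases "\<gamma> = {}")
        case False
        then have max: "Max \<gamma> \<in> \<gamma>"
          using insert by simp
        then have "Max \<gamma> < b" "Max \<gamma> \<in> {1..n}"
          using insert by auto
        with False insert show ?thesis
          by (intro disjI2 bexI[of _ "G (Max \<gamma>)"] conjI mono) (use G(1) in auto)
      qed simp
      then have "((\<Sum>i\<in>\<gamma>. \<alpha> (G i)) + \<alpha> (G b), (\<Sum>i\<in>\<gamma>. \<Sum>t\<in>H (G i). f i t) + sum (f b) (H (G b))) \<in> T (G b)"
        using G(1) f b by (intro step) auto
      ultimately show ?case
        using insert(1) \<open>b \<notin> \<gamma>\<close> by (simp add: add.commute)
    qed simp
    then have "(\<Sum>i\<in>\<beta>. \<alpha> (G i), \<Sum>i\<in>\<beta>. \<Sum>t\<in>H (G i). f i t) \<in> T (G (Max \<beta>))"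
      using \<beta> by (simp add: finite_nonempty_subsets_iff)
    moreover have "Max \<beta> \<in> {1..n}"
      using \<beta> Max_in[of \<beta>] unfolding finite_nonempty_subsets_iff by blast
    ultimately show ?thesis
      using G(1) P by (intro T[of "G (Max \<beta>)"]) auto
  qed
  show ?thesis
    using \<alpha> H less chain_sum by (intro bexI[of _ \<alpha>] bexI[of _ H] conjI ballI allI impI) blast+
qed

end
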